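(* Let $k\in\mathbb{N}$ and $a_1,\dots,a_k\in\mathbb{N}$, and let $A_\pi:\Lambda_k\to\bigoplus_{\mathbb{N}}\mathbb{Z}$ be the linearization, $A_\pi(e_\alpha)=a_1e_{\alpha_1}+\cdots+a_ke_{\alpha_k}$, of the width-$k$ monomial map $\pi:y_\alpha\mapsto x_{\alpha_1}^{a_1}\cdots x_{\alpha_k}^{a_k}$. Let $b_1,\dots,b_{k-1}\in\mathbb{Z}^k$ be any lattice basis of $\{v\in\mathbb{Z}^k : a_1v_1+\cdots+a_kv_k=0\}$. For each $1\le j\le k$ choose arbitrary pairwise distinct indices $m^{(j)}_l\ge 3$ ($l\in[k]$, $l\ne j$) and set $$f_j := e_{m^{(j)}_1\dots m^{(j)}_{j-1}\,1\,m^{(j)}_{j+1}\dots m^{(j)}_k}-e_{m^{(j)}_1\dots m^{(j)}_{j-1}\,2\,m^{(j)}_{j+1}\dots m^{(j)}_k}\in\Lambda_k .$$ For $1\le i\le k-1$ write $b_i=(c_{i1},\dots,c_{ik})$ and set $w_i:=c_{i1}f_1+\cdots+c_{ik}f_k$. Then $\mathrm{Quad}^{(k)}\cup\{w_1,\dots,w_{k-1}\}$ is an equivariant lattice generating set of $\ker(A_\pi)$.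
   Context: $\mathbb{N}=\{1,2,\dots\}$ and $[n]=\{1,\dots,n\}$. $\Lambda_k$ denotes the free abelian group with basis $\{e_\alpha : \alpha=(\alpha_1,\dots,\alpha_k)\in\mathbb{N}^k,\ \alpha_1,\dots,\alpha_k \text{ pairwise distinct}\}$; we write $e_{\alpha_1\dots\alpha_k}$ for $e_\alpha$. $\bigoplus_{\mathbb{N}}\mathbb{Z}$ has standard basis $e_i$, $i\in\mathbb{N}$. $S_\infty$ is the group of all bijections $\mathbb{N}\to\mathbb{N}$; it acts on $\Lambda_k$ by $\sigma(e_{\alpha_1\dots\alpha_k})=e_{\sigma(\alpha_1)\dots\sigma(\alpha_k)}$. A subset $V$ of an $S_\infty$-stable subgroup $L\subseteq\Lambda_k$ is an equivariant lattice generating set of $L$ if the $S_\infty$-orbits of the elements of $V$ generate $L$ as an abelian group. $\mathrm{Quad}^{(k)}$ is the set of all elements $$e_{i_1\dots i_r\dots i_s\dots i_k}+e_{i_1\dots i'_r\dots i'_s\dots i_k}-e_{i_1\dots i'_r\dots i_s\dots i_k}-e_{i_1\dots i_r\dots i'_s\dots i_k}$$ with $1\le r<s\le k$ and all $i_l,i'_l\in[k+2]$, such that each of the four multi-indices occurring has pairwise distinct entries (multi-indices not displayed as changed agree in all positions other than $r,s$). *)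

theory Defs
  imports
    Complex_Main
    "HOL-Library.Poly_Mapping"
    "HOL-Algebra.Free_Abelian_Groups"
    "HOL-Algebra.Generated_Groups"
    "HOL-Algebra.Bij"
begin

text \<open>
  The natural numbers start at 1 here, so index sets are \<open>{1..}\<close> and \<open>{1..k}\<close>.  Multi-indices are
  extensional functions on \<open>{1..k}\<close>, so that distinct functions are distinct multi-indices.
\<close>

definition multi_index :: "nat \<Rightarrow> (nat \<Rightarrow> nat) set" where
  "multi_index k = {\<alpha> \<in> {1..k} \<rightarrow>\<^sub>E {1..}. inj_on \<alpha> {1..k}}"

definition Lam :: "nat \<Rightarrow> ((nat \<Rightarrow> nat) \<Rightarrow>\<^sub>0 int) monoid" where
  "Lam k = free_Abelian_group (multi_index k)"

text \<open>
  \<open>S\<^sub>\<infinity>\<close> is \<open>BijGroup {1..}\<close>: all bijections of \<open>{1..}\<close>, not only the finitary ones.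
\<close>

definition perm_act :: "nat \<Rightarrow> (nat \<Rightarrow> nat) \<Rightarrow> ((nat \<Rightarrow> nat) \<Rightarrow>\<^sub>0 int) \<Rightarrow> ((nat \<Rightarrow> nat) \<Rightarrow>\<^sub>0 int)" where
  "perm_act k \<sigma> = frag_extend (\<lambda>\<alpha>. frag_of (compose {1..k} \<sigma> \<alpha>))"

definition perm_orbit :: "nat \<Rightarrow> ((nat \<Rightarrow> nat) \<Rightarrow>\<^sub>0 int) \<Rightarrow> ((nat \<Rightarrow> nat) \<Rightarrow>\<^sub>0 int) set" where
  "perm_orbit k v = {perm_act k \<sigma> v | \<sigma>. \<sigma> \<in> carrier (BijGroup {1..})}"

definition equivariant_lattice_generating_set ::
    "nat \<Rightarrow> ((nat \<Rightarrow> nat) \<Rightarrow>\<^sub>0 int) set \<Rightarrow> ((nat \<Rightarrow> nat) \<Rightarrow>\<^sub>0 int) set \<Rightarrow> bool" where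
  "equivariant_lattice_generating_set k L V \<longleftrightarrow>
     subgroup L (Lam k) \<and>
     (\<forall>\<sigma> \<in> carrier (BijGroup {1..}). \<forall>x \<in> L. perm_act k \<sigma> x \<in> L) \<and>
     V \<subseteq> L \<and>
     generate (Lam k) (\<Union>v \<in> V. perm_orbit k v) = L"

text \<open>The linearization \<open>A\<^sub>\<pi>\<close> of the monomial map with exponents \<open>a 1, \<dots>, a k\<close>.\<close>

definition A_lin :: "nat \<Rightarrow> (nat \<Rightarrow> nat) \<Rightarrow> ((nat \<Rightarrow> nat) \<Rightarrow>\<^sub>0 int) \<Rightarrow> (nat \<Rightarrow>\<^sub>0 int)" where
  "A_lin k a = frag_extend (\<lambda>\<alpha>. \<Sum>j = 1..k. frag_cmul (int (a j)) (frag_of (\<alpha> j)))"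

definition ker_A :: "nat \<Rightarrow> (nat \<Rightarrow> nat) \<Rightarrow> ((nat \<Rightarrow> nat) \<Rightarrow>\<^sub>0 int) set" where
  "ker_A k a = kernel (Lam k) (free_Abelian_group {1..}) (A_lin k a)"

text \<open>
  In \<open>Quad\<close>, \<open>\<alpha>\<close> is the multi-index \<open>i\<^sub>1 \<dots> i\<^sub>k\<close>, and \<open>x\<close>, \<open>y\<close> are the alternative entries
  \<open>i'\<^sub>r\<close>, \<open>i'\<^sub>s\<close>.  Membership in \<open>multi_index k\<close> is the distinctness of the entries.
\<close>

definition Quad :: "nat \<Rightarrow> ((nat \<Rightarrow> nat) \<Rightarrow>\<^sub>0 int) set" where
  "Quad k =
     {frag_of \<alpha> + frag_of (\<alpha>(r := x, s := y)) - frag_of (\<alpha>(r := x)) - frag_of (\<alpha>(s := y))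
      | \<alpha> r s x y.
        1 \<le> r \<and> r < s \<and> s \<le> k \<and>
        \<alpha> \<in> {1..k} \<rightarrow>\<^sub>E {1..k + 2} \<and> x \<in> {1..k + 2} \<and> y \<in> {1..k + 2} \<and>
        \<alpha> \<in> multi_index k \<and> \<alpha>(r := x, s := y) \<in> multi_index k \<and>
        \<alpha>(r := x) \<in> multi_index k \<and> \<alpha>(s := y) \<in> multi_index k}"

text \<open>
  \<open>\<int>\<^sup>k\<close> is realised as the free abelian group on \<open>{1..k}\<close>; the \<open>j\<close>-th coordinate of \<open>v\<close> is
  \<open>Poly_Mapping.lookup v j\<close>.
\<close>

definition relation_lattice :: "nat \<Rightarrow> (nat \<Rightarrow> nat) \<Rightarrow> (nat \<Rightarrow>\<^sub>0 int) set" where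
  "relation_lattice k a =
     {v \<in> carrier (free_Abelian_group {1..k}).
        (\<Sum>j = 1..k. int (a j) * Poly_Mapping.lookup v j) = 0}"

interpretation frag_module: module frag_cmul
  by unfold_locales (simp_all add: frag_cmul_distrib frag_cmul_distrib2)

definition lattice_basis :: "'i set \<Rightarrow> ('i \<Rightarrow> ('a \<Rightarrow>\<^sub>0 int)) \<Rightarrow> ('a \<Rightarrow>\<^sub>0 int) set \<Rightarrow> bool" where
  "lattice_basis I b L \<longleftrightarrow>
     inj_on b I \<and> frag_module.independent (b ` I) \<and> frag_module.span (b ` I) = L"

text \<open>\<open>f\<^sub>j\<close> for the filler entries \<open>m l\<close> (\<open>l \<noteq> j\<close>); the value \<open>m j\<close> is irrelevant.\<close>

definition f_elem :: "nat \<Rightarrow> nat \<Rightarrow> (nat \<Rightarrow> nat) \<Rightarrow> ((nat \<Rightarrow> nat) \<Rightarrow>\<^sub>0 int)" where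
  "f_elem k j m =
     frag_of (restrict (m(j := 1)) {1..k}) - frag_of (restrict (m(j := 2)) {1..k})"

end

theory Submission
  imports Defs
begin

text \<open>
  Work modulo the subgroup \<open>G\<close> generated by the orbits.  A quadratic element in the positions
  \<open>j\<close>, \<open>s\<close> says that the difference of two basis elements which differ only in position \<open>j\<close>,
  with entries \<open>p\<close> and \<open>q\<close> there, does not change when the entry in position \<open>s\<close> changes.
  Since \<open>\<nat>\<close> is infinite, any two choices of the remaining entries are joined by such changes, by
  way of entries that occur in neither, so modulo \<open>G\<close> this difference depends on \<open>j\<close>, \<open>p\<close> and \<open>q\<close>
  only (\<open>line_congruent\<close>).

  Fix a multi-index \<open>\<delta>\<close> and a number \<open>t\<close> with all entries so large that they do not interfere with
  the element \<open>x\<close> of the kernel under consideration.  Replacing the entries of \<open>\<delta>\<close> by those of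
  \<open>\<alpha>\<close> one position at a time writes \<open>e\<^sub>\<alpha>\<close> modulo \<open>G\<close> as a constant \<open>K\<close>, not depending on
  \<open>\<alpha>\<close>, plus the sum over \<open>j\<close> of the differences from \<open>t\<close> to \<open>\<alpha>\<^sub>j\<close> in position \<open>j\<close>
  (\<open>frag_of_congruent_sum_lines\<close>).  Hence \<open>x\<close> is congruent to its coefficient sum times \<open>K\<close> plus an
  element that depends only on its \<open>k\<close> marginals, the images of \<open>x\<close> under \<open>e\<^sub>\<alpha> \<mapsto> e\<^bsub>\<alpha> j\<^esub>\<close>.
  The condition on \<open>x\<close> to lie in the kernel is that the marginals, weighted by the exponents,
  add up to zero.  As the exponents are positive, the coefficient sum vanishes
  (\<open>frag_extend_const_ker_A\<close>).  Moreover, for each entry \<open>p\<close> the vector of the coefficients of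
  \<open>p\<close> in the \<open>k\<close> marginals lies in the relation lattice, so what remains is a sum over \<open>p\<close> of
  combinations of the differences from \<open>t\<close> to \<open>p\<close> with coefficient vectors in that lattice
  (\<open>sum_marginals_in_subspace\<close>).

  Such a combination is linear in the coefficient vector, so the basis vectors \<open>b\<^sub>i\<close> suffice; and for
  \<open>b\<^sub>i\<close> it is, up to the choice of the other entries, the image of \<open>w\<^sub>i\<close> under a permutation with
  \<open>1 \<mapsto> p\<close> and \<open>2 \<mapsto> t\<close> (\<open>ker_A_subset\<close>).  The converse inclusion is a direct computation of
  marginals.
\<close>

section \<open>Permutations and multi-indices\<close>

text \<open>
  The parts of \<open>S \<union> g ` S\<close> outside \<open>S\<close> and outside \<open>g ` S\<close> have the same size because \<open>S\<close> is
  finite, so \<open>g\<close> extends to a permutation of this union, and by the identity to one of \<open>U\<close>.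
\<close>

lemma bij_betw_extend_finite_inj:
  assumes "finite S" "S \<subseteq> U" "inj_on g S" "g ` S \<subseteq> U"
  shows "\<exists>\<sigma>. bij_betw \<sigma> U U \<and> (\<forall>x\<in>S. \<sigma> x = g x)"
proof -
  let ?T = "S \<union> g ` S"
  have "card (?T - S) = card (?T - g ` S)"
    using assms card_image[of g S] by (simp add: card_Diff_subset)
  then obtain h where h: "bij_betw h (?T - S) (?T - g ` S)"
    using finite_same_card_bij[of "?T - S" "?T - g ` S"] assms(1) by auto
  have 1: "bij_betw (\<lambda>x. if x \<in> S then g x else h x) (S \<union> (?T - S)) (g ` S \<union> (?T - g ` S))"
    by (rule bij_betw_disjoint_Un) (use h assms in \<open>auto simp: bij_betw_def\<close>)
  have T: "S \<union> (?T - S) = ?T" "g ` S \<union> (?T - g ` S) = ?T" by auto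
  have 2: "bij_betw (\<lambda>x. if x \<in> ?T then (if x \<in> S then g x else h x) else id x)
              (?T \<union> (U - ?T)) (?T \<union> (U - ?T))"
    by (rule bij_betw_disjoint_Un) (use 1[unfolded T] bij_betw_id[of "U - ?T"] in \<open>auto simp: id_def\<close>)
  have "?T \<union> (U - ?T) = U" using assms by auto
  with 2 show ?thesis by (intro exI[of _ "\<lambda>x. if x \<in> ?T then (if x \<in> S then g x else h x) else id x"]) auto
qed

lemma BijGroup_extend_finite_inj:
  assumes "finite S" "S \<subseteq> U" "inj_on g S" "g ` S \<subseteq> U"
  obtains \<sigma> where "\<sigma> \<in> carrier (BijGroup U)" "\<And>x. x \<in> S \<Longrightarrow> \<sigma> x = g x"
proof -
  obtain \<sigma> where \<sigma>: "bij_betw \<sigma> U U" "\<forall>x\<in>S. \<sigma> x = g x"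
    using bij_betw_extend_finite_inj[OF assms] by blast
  show thesis
  proof
    show "restrict \<sigma> U \<in> carrier (BijGroup U)"
      using \<sigma> by (auto simp: BijGroup_def Bij_def cong: bij_betw_cong)
    show "restrict \<sigma> U x = g x" if "x \<in> S" for x using \<sigma> that assms by auto
  qed
qed

lemma multi_index_iff:
  "\<alpha> \<in> multi_index k \<longleftrightarrow>
     (\<forall>l\<in>{1..k}. 1 \<le> \<alpha> l) \<and> (\<forall>l. l \<notin> {1..k} \<longrightarrow> \<alpha> l = undefined) \<and> inj_on \<alpha> {1..k}"
  by (auto simp: multi_index_def PiE_iff extensional_def)

lemma multi_index_neq:
  "\<alpha> \<in> multi_index k \<Longrightarrow> i \<in> {1..k} \<Longrightarrow> j \<in> {1..k} \<Longrightarrow> i \<noteq> j \<Longrightarrow> \<alpha> i \<noteq> \<alpha> j"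
  unfolding multi_index_iff by (blast dest: inj_onD)

lemma multi_index_upd:
  assumes "\<alpha> \<in> multi_index k" "j \<in> {1..k}" "1 \<le> p" "p \<notin> \<alpha> ` {1..k}"
  shows "\<alpha>(j := p) \<in> multi_index k"
  using assms inj_on_fun_updI[of \<alpha> "{1..k}" p j] by (auto simp: multi_index_iff)

lemma compose_upd: "j \<in> A \<Longrightarrow> compose A \<sigma> (\<alpha>(j := p)) = (compose A \<sigma> \<alpha>)(j := \<sigma> p)"
  by (auto simp: compose_def)

lemma compose_multi_index:
  assumes "\<sigma> \<in> carrier (BijGroup {1..})" "\<alpha> \<in> multi_index k"
  shows "compose {1..k} \<sigma> \<alpha> \<in> multi_index k"
proof -
  have \<sigma>: "inj_on \<sigma> {1..}" "\<sigma> ` {1..} \<subseteq> {1..}"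
    using assms(1) by (auto simp: BijGroup_def Bij_def bij_betw_def)
  have \<alpha>: "\<alpha> ` {1..k} \<subseteq> {1..}" "inj_on \<alpha> {1..k}"
    using assms(2) by (auto simp: multi_index_iff)
  have "inj_on (\<sigma> \<circ> \<alpha>) {1..k}"
    using \<alpha> \<sigma> by (blast intro: comp_inj_on inj_on_subset)
  then have "inj_on (compose {1..k} \<sigma> \<alpha>) {1..k}"
    by (rule inj_on_cong[THEN iffD1, rotated]) (simp add: compose_def)
  moreover have "1 \<le> compose {1..k} \<sigma> \<alpha> l" if "l \<in> {1..k}" for l
    using that \<alpha>(1) \<sigma>(2) by (auto simp: compose_def image_subset_iff)
  ultimately show ?thesis by (auto simp: multi_index_iff compose_def)
qed

section \<open>Congruences modulo the quadratic elements\<close>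

text \<open>
  In the notation of the statement, \<open>e\<^bsub>\<dots> p \<dots>\<^esub> - e\<^bsub>\<dots> q \<dots>\<^esub>\<close>, with \<open>p\<close> and \<open>q\<close> in position
  \<open>j\<close> and the other entries taken from \<open>\<alpha>\<close>.
\<close>

definition line :: "nat \<Rightarrow> (nat \<Rightarrow> nat) \<Rightarrow> nat \<Rightarrow> nat \<Rightarrow> ((nat \<Rightarrow> nat) \<Rightarrow>\<^sub>0 int)" where
  "line j \<alpha> p q = frag_of (\<alpha>(j := p)) - frag_of (\<alpha>(j := q))"

text \<open>
  The intermediate stages, as \<open>n\<close> runs from \<open>0\<close> to \<open>k\<close>, of changing \<open>\<beta>\<close> into \<open>\<alpha>\<close> one position
  at a time.
\<close>

definition hybrid :: "nat \<Rightarrow> (nat \<Rightarrow> nat) \<Rightarrow> (nat \<Rightarrow> nat) \<Rightarrow> nat \<Rightarrow> nat" where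
  "hybrid n \<alpha> \<beta> = (\<lambda>l. if l \<le> n then \<alpha> l else \<beta> l)"

lemma hybrid_upd: "(hybrid n \<alpha> \<beta>)(j := p) = hybrid n (\<alpha>(j := p)) (\<beta>(j := p))"
  by (auto simp: hybrid_def)

lemma hybrid_Suc: "hybrid (Suc n) \<alpha> \<beta> = (hybrid n \<alpha> \<beta>)(Suc n := \<alpha> (Suc n))"
  by (auto simp: hybrid_def fun_eq_iff le_Suc_eq)

lemma hybrid_0: "\<alpha> \<in> multi_index k \<Longrightarrow> \<beta> \<in> multi_index k \<Longrightarrow> hybrid 0 \<alpha> \<beta> = \<beta>"
  by (auto simp: hybrid_def multi_index_iff)

lemma hybrid_full: "\<alpha> \<in> multi_index k \<Longrightarrow> \<beta> \<in> multi_index k \<Longrightarrow> hybrid k \<alpha> \<beta> = \<alpha>"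
  by (auto simp: hybrid_def multi_index_iff)

lemma hybrid_multi_index:
  assumes "\<alpha> \<in> multi_index k" "\<beta> \<in> multi_index k"
    and "\<And>l l'. \<lbrakk>l \<in> {1..k}; l' \<in> {1..k}; l \<le> n; n < l'\<rbrakk> \<Longrightarrow> \<alpha> l \<noteq> \<beta> l'"
  shows "hybrid n \<alpha> \<beta> \<in> multi_index k"
proof -
  have "hybrid n \<alpha> \<beta> i \<noteq> hybrid n \<alpha> \<beta> j" if "i \<in> {1..k}" "j \<in> {1..k}" "i < j" for i j
    using that multi_index_neq[OF assms(1), of i j] multi_index_neq[OF assms(2), of i j] assms(3)[of i j]
    by (auto simp: hybrid_def)
  then have "inj_on (hybrid n \<alpha> \<beta>) {1..k}" by (rule linorder_inj_onI') auto
  then show ?thesis using assms(1,2) by (auto simp: multi_index_iff hybrid_def)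
qed

text \<open>
  The two alternative entries \<open>x\<close>, \<open>y\<close> and all others range over the positive integers here, and
  \<open>r\<close>, \<open>s\<close> are in either order: this is closure under the orbits of the quadratic elements in
  the form in which congruences modulo \<open>G\<close> use it.
\<close>

locale quad_closed =
  fixes k :: nat and G :: "((nat \<Rightarrow> nat) \<Rightarrow>\<^sub>0 int) set"
  assumes subspace: "frag_module.subspace G"
    and quad: "\<And>\<alpha> r s x y. \<lbrakk>r \<in> {1..k}; s \<in> {1..k}; r \<noteq> s; \<alpha> \<in> multi_index k;
         \<alpha>(r := x, s := y) \<in> multi_index k; \<alpha>(r := x) \<in> multi_index k; \<alpha>(s := y) \<in> multi_index k\<rbrakk>
       \<Longrightarrow> frag_of \<alpha> + frag_of (\<alpha>(r := x, s := y)) - frag_of (\<alpha>(r := x)) - frag_of (\<alpha>(s := y)) \<in> G"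
begin

lemmas G_add = frag_module.subspace_add[OF subspace]
lemmas G_diff = frag_module.subspace_diff[OF subspace]

text \<open>
  If \<open>\<alpha>\<close> and \<open>\<gamma>\<close> share no entry outside position \<open>j\<close>, then every stage between them has
  pairwise distinct entries, with \<open>p\<close> as well as with \<open>q\<close> in position \<open>j\<close>, and passing from one
  stage to the next is a quadratic relation.
\<close>

lemma line_congruent_disjoint:
  assumes j: "j \<in> {1..k}"
    and \<alpha>: "\<alpha>(j := p) \<in> multi_index k" "\<alpha>(j := q) \<in> multi_index k"
    and \<gamma>: "\<gamma>(j := p) \<in> multi_index k" "\<gamma>(j := q) \<in> multi_index k"
    and disj: "\<And>l l'. \<lbrakk>l \<in> {1..k} - {j}; l' \<in> {1..k} - {j}\<rbrakk> \<Longrightarrow> \<gamma> l \<noteq> \<alpha> l'"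
  shows "line j \<gamma> p q - line j \<alpha> p q \<in> G"
proof -
  have hyb: "(hybrid n \<gamma> \<alpha>)(j := z) \<in> multi_index k" if "z \<in> {p, q}" for n z
    unfolding hybrid_upd
  proof (rule hybrid_multi_index)
    show g: "\<gamma>(j := z) \<in> multi_index k" and a: "\<alpha>(j := z) \<in> multi_index k" using \<alpha> \<gamma> that by blast+
    fix l l' assume l: "l \<in> {1..k}" "l' \<in> {1..k}" "l \<le> n" "n < l'"
    have "\<gamma> l \<noteq> z" if "l \<noteq> j" using multi_index_neq[OF g l(1) j that] that by simp
    moreover have "\<alpha> l' \<noteq> z" if "l' \<noteq> j" using multi_index_neq[OF a l(2) j that] that by simp
    ultimately show "(\<gamma>(j := z)) l \<noteq> (\<alpha>(j := z)) l'"
      using l disj[of l l'] by (cases "l = j"; cases "l' = j") auto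
  qed
  have "n \<le> k \<Longrightarrow> line j (hybrid n \<gamma> \<alpha>) p q - line j \<alpha> p q \<in> G" for n
  proof (induction n)
    case 0
    then show ?case
      using \<alpha> \<gamma> by (simp add: line_def hybrid_upd hybrid_0 frag_module.subspace_0[OF subspace])
  next
    case (Suc n)
    let ?h = "hybrid n \<gamma> \<alpha>"
    have "line j (hybrid (Suc n) \<gamma> \<alpha>) p q - line j ?h p q \<in> G"
    proof (cases "Suc n = j")
      case True
      then show ?thesis
        by (simp add: line_def hybrid_Suc frag_module.subspace_0[OF subspace] flip: True)
    next
      case False
      \<comment> \<open>The quadratic element for the positions \<open>j\<close>, \<open>Suc n\<close> is the difference of the two lines.\<close>
      have "frag_of (?h(j := q)) + frag_of ((?h(j := q))(j := p, Suc n := \<gamma> (Suc n)))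
              - frag_of ((?h(j := q))(j := p)) - frag_of ((?h(j := q))(Suc n := \<gamma> (Suc n))) \<in> G"
        using j Suc.prems False hyb[of p n] hyb[of q n] hyb[of p "Suc n"] hyb[of q "Suc n"]
        by (intro quad) (auto simp: hybrid_Suc fun_upd_twist)
      then show ?thesis
        using False by (simp add: line_def hybrid_Suc fun_upd_twist algebra_simps)
    qed
    from G_add[OF this Suc.IH] Suc.prems show ?case by simp
  qed
  from this[of k] show ?thesis
    using \<alpha> \<gamma> by (simp add: line_def hybrid_upd hybrid_full)
qed

text \<open>
  In general the stages between \<open>\<alpha>\<close> and \<open>\<beta>\<close> could repeat an entry.  Both are therefore compared
  with a third choice of the other entries, all larger than \<open>p\<close>, \<open>q\<close> and the entries of \<open>\<alpha>\<close>, \<open>\<beta>\<close>.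
\<close>

lemma line_congruent:
  assumes j: "j \<in> {1..k}"
    and \<alpha>: "\<alpha>(j := p) \<in> multi_index k" "\<alpha>(j := q) \<in> multi_index k"
    and \<beta>: "\<beta>(j := p) \<in> multi_index k" "\<beta>(j := q) \<in> multi_index k"
  shows "line j \<alpha> p q - line j \<beta> p q \<in> G"
proof -
  define N where "N = Max (insert p (insert q (\<alpha> ` {1..k} \<union> \<beta> ` {1..k})))"
  have N: "p \<le> N" "q \<le> N" "\<And>l. l \<in> {1..k} \<Longrightarrow> \<alpha> l \<le> N" "\<And>l. l \<in> {1..k} \<Longrightarrow> \<beta> l \<le> N"
    unfolding N_def by (rule Max_ge; simp)+
  define \<gamma> where "\<gamma> = (\<lambda>l\<in>{1..k}. N + l)"
  have pos: "1 \<le> p" "1 \<le> q" using j \<alpha> unfolding multi_index_iff by (metis fun_upd_same)+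
  have \<gamma>: "\<gamma>(j := p) \<in> multi_index k" "\<gamma>(j := q) \<in> multi_index k"
    using N(1,2) j pos by (auto simp: multi_index_iff \<gamma>_def inj_on_def)
  have "\<gamma> l \<noteq> \<alpha> l'" "\<gamma> l \<noteq> \<beta> l'" if "l \<in> {1..k} - {j}" "l' \<in> {1..k} - {j}" for l l'
    using that N(3,4)[of l'] by (auto simp: \<gamma>_def)
  then have "line j \<gamma> p q - line j \<alpha> p q \<in> G" "line j \<gamma> p q - line j \<beta> p q \<in> G"
    using line_congruent_disjoint[OF j] \<alpha> \<beta> \<gamma> by blast+
  from G_diff[OF this(2,1)] show ?thesis by simp
qed

text \<open>
  The telescoping sum over the stages between \<open>\<delta>\<close> and \<open>\<alpha>\<close>: each stage differs from the previous
  one by a line whose other entries are mixed, and \<open>line_congruent\<close> replaces them by those of \<open>\<delta>\<close>.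
\<close>

lemma frag_of_congruent_sum_lines:
  assumes \<alpha>: "\<alpha> \<in> multi_index k" and \<delta>: "\<delta> \<in> multi_index k"
    and disj: "\<And>l l'. \<lbrakk>l \<in> {1..k}; l' \<in> {1..k}\<rbrakk> \<Longrightarrow> \<alpha> l \<noteq> \<delta> l'"
  shows "frag_of \<alpha> - frag_of \<delta> - (\<Sum>j = 1..k. line j \<delta> (\<alpha> j) (\<delta> j)) \<in> G"
proof -
  have hyb: "hybrid n \<alpha> \<delta> \<in> multi_index k" for n
    using \<alpha> \<delta> disj by (intro hybrid_multi_index) auto
  have "n \<le> k \<Longrightarrow>
      frag_of (hybrid n \<alpha> \<delta>) - frag_of \<delta> - (\<Sum>j = 1..n. line j \<delta> (\<alpha> j) (\<delta> j)) \<in> G" for n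
  proof (induction n)
    case 0
    then show ?case using \<alpha> \<delta> by (simp add: hybrid_0 frag_module.subspace_0[OF subspace])
  next
    case (Suc n)
    let ?h = "hybrid n \<alpha> \<delta>" and ?j = "Suc n"
    have h: "?h(?j := \<delta> ?j) = ?h" by (auto simp: hybrid_def)
    have l: "line ?j ?h (\<alpha> ?j) (\<delta> ?j) = frag_of (hybrid ?j \<alpha> \<delta>) - frag_of ?h"
      by (simp only: line_def hybrid_Suc h)
    have "\<alpha> ?j \<notin> \<delta> ` {1..k}" using disj[of ?j] Suc.prems by (simp add: image_iff)
    then have "\<delta>(?j := \<alpha> ?j) \<in> multi_index k"
      using \<alpha> \<delta> Suc.prems by (intro multi_index_upd) (auto simp: multi_index_iff)
    then have "line ?j ?h (\<alpha> ?j) (\<delta> ?j) - line ?j \<delta> (\<alpha> ?j) (\<delta> ?j) \<in> G"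
      using hyb[of n] hyb[of ?j] Suc.prems \<delta> h by (intro line_congruent) (auto simp: hybrid_Suc)
    from G_add[OF this Suc.IH] Suc.prems show ?case
      by (simp add: l algebra_simps)
  qed
  from this[of k] show ?thesis using \<alpha> \<delta> by (simp add: hybrid_full)
qed

end

section \<open>Marginals and the kernel\<close>

definition marginal :: "nat \<Rightarrow> ((nat \<Rightarrow> nat) \<Rightarrow>\<^sub>0 int) \<Rightarrow> (nat \<Rightarrow>\<^sub>0 int)" where
  "marginal j = frag_extend (\<lambda>\<alpha>. frag_of (\<alpha> j))"

text \<open>
  This turns membership in the kernel into a linear condition on the marginals.
\<close>

lemma A_lin_eq_marginals: "A_lin k a x = (\<Sum>j = 1..k. frag_cmul (int (a j)) (marginal j x))"
proof (induction x rule: frag_induction[OF subset_UNIV])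
  case (3 x y)
  then show ?case
    by (simp add: A_lin_def marginal_def frag_extend_diff frag_module.scale_right_diff_distrib
        sum_subtractf)
qed (simp_all add: A_lin_def marginal_def)

lemma ker_A_iff: "x \<in> ker_A k a \<longleftrightarrow> Poly_Mapping.keys x \<subseteq> multi_index k \<and> A_lin k a x = 0"
  by (auto simp: ker_A_def kernel_def Lam_def)

lemma subspace_keys_subset: "frag_module.subspace {x :: 'a \<Rightarrow>\<^sub>0 int. Poly_Mapping.keys x \<subseteq> S}"
  unfolding frag_module.subspace_def using keys_add by fastforce

lemma subspace_ker_A: "frag_module.subspace (ker_A k a)"
proof -
  have "frag_module.subspace {x. A_lin k a x = 0}"
    by (simp add: frag_module.subspace_def A_lin_def frag_extend_add frag_extend_cmul)
  from frag_module.subspace_inter[OF subspace_keys_subset this]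
  show ?thesis by (rule arg_cong[where f = frag_module.subspace, THEN iffD1, rotated])
    (auto simp: ker_A_iff)
qed

lemma frag_extend_const_frag_extend_of:
  "frag_extend (\<lambda>_. K) (frag_extend (\<lambda>\<alpha>. frag_of (g \<alpha>)) x) = frag_extend (\<lambda>_. K) x"
  using frag_extend_compose[of "\<lambda>_. K" g x] by (simp add: comp_def)

text \<open>
  The value of \<open>frag_extend (\<lambda>_. K)\<close> is \<open>K\<close> times the coefficient sum.  A marginal has the same
  coefficient sum as \<open>x\<close>, so the coefficient sum of \<open>A_lin k a x\<close> is that of \<open>x\<close> times the
  positive number \<open>\<Sum>j. a j\<close>, and free abelian groups have no torsion.
\<close>

lemma frag_extend_const_ker_A:
  assumes "1 \<le> k" "\<And>j. j \<in> {1..k} \<Longrightarrow> 1 \<le> a j" "x \<in> ker_A k a"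
  shows "frag_extend (\<lambda>_. K) x = 0"
proof -
  have "0 = frag_extend (\<lambda>_. K) (A_lin k a x)" using assms(3) by (simp add: ker_A_iff)
  also have "\<dots> = (\<Sum>j = 1..k. frag_cmul (int (a j)) (frag_extend (\<lambda>_. K) x))"
    by (simp add: A_lin_eq_marginals frag_extend_sum comp_def frag_extend_cmul marginal_def
        frag_extend_const_frag_extend_of)
  also have "\<dots> = frag_cmul (\<Sum>j = 1..k. int (a j)) (frag_extend (\<lambda>_. K) x)"
    by (simp add: frag_module.scale_sum_left)
  finally have "(\<Sum>j = 1..k. int (a j)) = 0 \<or> frag_extend (\<lambda>_. K) x = 0" by simp
  moreover have "0 < (\<Sum>j = 1..k. int (a j))"
    using assms(1,2) by (intro sum_pos) (auto simp: Suc_le_eq)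
  ultimately show ?thesis by simp
qed

lemma keys_marginal: "Poly_Mapping.keys (marginal j x) \<subseteq> (\<lambda>\<alpha>. \<alpha> j) ` Poly_Mapping.keys x"
  using keys_frag_extend[of "\<lambda>\<alpha>. frag_of (\<alpha> j)" x] by (auto simp: marginal_def)

lemma frag_extend_superset:
  assumes "finite P" "Poly_Mapping.keys x \<subseteq> P"
  shows "frag_extend g x = (\<Sum>p\<in>P. frag_cmul (Poly_Mapping.lookup x p) (g p))"
  unfolding frag_extend_def
  by (rule sum.mono_neutral_left) (use assms in \<open>auto simp: in_keys_iff\<close>)

text \<open>
  The sum \<open>c\<^sub>1 g\<^sub>1 + \<dots> + c\<^sub>k g\<^sub>k\<close> for \<open>v = (c\<^sub>1, \<dots>, c\<^sub>k)\<close>; for \<open>v = b\<^sub>i\<close> and \<open>g = f\<close> it is \<open>w\<^sub>i\<close>.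
\<close>

definition combination :: "nat \<Rightarrow> (nat \<Rightarrow> ('a \<Rightarrow>\<^sub>0 int)) \<Rightarrow> (nat \<Rightarrow>\<^sub>0 int) \<Rightarrow> ('a \<Rightarrow>\<^sub>0 int)" where
  "combination k g v = (\<Sum>j = 1..k. frag_cmul (Poly_Mapping.lookup v j) (g j))"

text \<open>
  Exchange the sums over the position \<open>j\<close> and over the entry \<open>p\<close>.  For fixed \<open>p\<close>, the coefficients
  of \<open>p\<close> in the marginals form a vector \<open>v p\<close>, whose weighted sum is the coefficient of \<open>p\<close> in
  \<open>A_lin k a x = 0\<close>; so \<open>v p\<close> lies in the relation lattice.
\<close>

lemma sum_marginals_in_subspace:
  assumes "frag_module.subspace G" and x: "x \<in> ker_A k a"
    and G: "\<And>p v. \<lbrakk>p \<in> (\<Union>j\<in>{1..k}. (\<lambda>\<alpha>. \<alpha> j) ` Poly_Mapping.keys x); v \<in> relation_lattice k a\<rbrakk>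
          \<Longrightarrow> combination k (\<lambda>j. g j p) v \<in> G"
  shows "(\<Sum>j = 1..k. frag_extend (g j) (marginal j x)) \<in> G"
proof -
  define P where "P = (\<Union>j\<in>{1..k}. (\<lambda>\<alpha>. \<alpha> j) ` Poly_Mapping.keys x)"
  define v where "v p = (\<Sum>j = 1..k. frag_cmul (Poly_Mapping.lookup (marginal j x) p) (frag_of j))" for p
  have lookup_v: "Poly_Mapping.lookup (v p) j = Poly_Mapping.lookup (marginal j x) p" if "j \<in> {1..k}" for p j
    using that by (simp add: v_def lookup_sum lookup_single when_def if_distrib cong: if_cong)
  have v: "v p \<in> relation_lattice k a" for p
  proof -
    have "Poly_Mapping.keys (v p) \<subseteq> {1..k}"
      using keys_sum[of _ "{1..k}"] by (force simp: v_def)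
    moreover have "(\<Sum>j = 1..k. int (a j) * Poly_Mapping.lookup (v p) j)
                     = Poly_Mapping.lookup (A_lin k a x) p"
      by (simp add: lookup_v A_lin_eq_marginals lookup_sum)
    ultimately show ?thesis using x by (simp add: relation_lattice_def ker_A_iff)
  qed
  have "(\<Sum>j = 1..k. frag_extend (g j) (marginal j x))
          = (\<Sum>j = 1..k. \<Sum>p\<in>P. frag_cmul (Poly_Mapping.lookup (v p) j) (g j p))"
  proof (rule sum.cong[OF refl])
    fix j assume j: "j \<in> {1..k}"
    have "frag_extend (g j) (marginal j x)
            = (\<Sum>p\<in>P. frag_cmul (Poly_Mapping.lookup (marginal j x) p) (g j p))"
      using keys_marginal[of j x] j by (intro frag_extend_superset) (auto simp: P_def)
    then show "frag_extend (g j) (marginal j x)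
            = (\<Sum>p\<in>P. frag_cmul (Poly_Mapping.lookup (v p) j) (g j p))"
      using j by (simp add: lookup_v)
  qed
  also have "\<dots> = (\<Sum>p\<in>P. combination k (\<lambda>j. g j p) (v p))"
    unfolding combination_def by (rule sum.swap)
  also have "\<dots> \<in> G"
    using G v by (intro frag_module.subspace_sum[OF assms(1)]) (auto simp: P_def)
  finally show ?thesis .
qed

lemma combination_in_subspace_span:
  assumes "frag_module.subspace G" "\<And>v. v \<in> B \<Longrightarrow> combination k g v \<in> G"
    and "v \<in> frag_module.span B"
  shows "combination k g v \<in> G"
proof -
  have zero: "combination k g 0 = 0" by (simp add: combination_def)
  have add: "combination k g (u + v) = combination k g u + combination k g v" for u v
    by (simp add: combination_def lookup_add frag_cmul_distrib sum.distrib)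
  have scale: "combination k g (frag_cmul c v) = frag_cmul c (combination k g v)" for c v
    by (simp add: combination_def frag_cmul_sum)
  have "frag_module.subspace {v. combination k g v \<in> G}"
    using assms(1) by (simp add: frag_module.subspace_def zero add scale)
  then show ?thesis using frag_module.span_minimal[of B "{v. combination k g v \<in> G}"] assms(2,3) by blast
qed

section \<open>Reduction of kernel elements\<close>

context quad_closed
begin

text \<open>
  The last assumption is what the orbit of \<open>w\<^sub>i\<close> provides for \<open>v = b\<^sub>i\<close>.  The remaining entries may
  vary with the position \<open>j\<close> because \<open>line_congruent\<close> replaces them by those of the one
  \<open>\<delta>\<close> chosen for the kernel element at hand.
\<close>

lemma ker_A_subset:
  assumes k: "1 \<le> k" and a: "\<And>j. j \<in> {1..k} \<Longrightarrow> 1 \<le> a j"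
    and span: "frag_module.span B = relation_lattice k a"
    and B: "\<And>v p t. \<lbrakk>v \<in> B; 1 \<le> p; 1 \<le> t; p \<noteq> t\<rbrakk> \<Longrightarrow>
        \<exists>\<beta>. (\<forall>j\<in>{1..k}. (\<beta> j)(j := p) \<in> multi_index k \<and> (\<beta> j)(j := t) \<in> multi_index k) \<and>
            combination k (\<lambda>j. line j (\<beta> j) p t) v \<in> G"
  shows "ker_A k a \<subseteq> G"
proof
  fix x assume x: "x \<in> ker_A k a"
  let ?P = "\<Union>j\<in>{1..k}. (\<lambda>\<alpha>. \<alpha> j) ` Poly_Mapping.keys x"
  define N where "N = Max (insert 0 ?P)"
  have N: "p \<le> N" if "p \<in> ?P" for p unfolding N_def using that by (intro Max_ge) auto
  have keys: "Poly_Mapping.keys x \<subseteq> multi_index k" using x by (simp add: ker_A_iff)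
  have pos: "1 \<le> p" if "p \<in> ?P" for p using that keys by (fastforce simp: multi_index_iff)
  \<comment> \<open>All entries of \<open>\<delta>\<close> and the base point \<open>t\<close> exceed the entries that occur in \<open>x\<close>.\<close>
  define \<delta> where "\<delta> = (\<lambda>l\<in>{1..k}. N + l)"
  define t where "t = N + k + 1"
  have \<delta>: "\<delta> \<in> multi_index k" by (auto simp: \<delta>_def multi_index_iff inj_on_def)
  have \<delta>_upd: "\<delta>(j := p) \<in> multi_index k" if "j \<in> {1..k}" "p \<in> insert t ?P" for j p
  proof (rule multi_index_upd[OF \<delta> that(1)])
    show "1 \<le> p" using that(2) pos[of p] by (auto simp: t_def)
    show "p \<notin> \<delta> ` {1..k}"
    proof (cases "p = t")
      case False
      then have "p \<le> N" using that(2) N[of p] by blast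
      then show ?thesis by (auto simp: \<delta>_def)
    qed (auto simp: \<delta>_def t_def)
  qed
  define K where "K = frag_of \<delta> + (\<Sum>j = 1..k. line j \<delta> t (\<delta> j))"
  \<comment> \<open>Modulo \<open>G\<close>, each \<open>e\<^sub>\<alpha>\<close> in the support of \<open>x\<close> is \<open>K\<close> plus the lines from \<open>t\<close> to its entries.\<close>
  have "y - frag_extend (\<lambda>_. K) y - (\<Sum>j = 1..k. frag_extend (\<lambda>p. line j \<delta> p t) (marginal j y)) \<in> G"
    if "Poly_Mapping.keys y \<subseteq> Poly_Mapping.keys x" for y
    using that
  proof (induction y rule: frag_induction)
    case zero
    then show ?case by (simp add: marginal_def frag_module.subspace_0[OF subspace])
  next
    case (one \<alpha>)
    have "\<alpha> l \<noteq> \<delta> l'" if "l \<in> {1..k}" "l' \<in> {1..k}" for l l'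
    proof -
      have "\<alpha> l \<le> N" using that one by (intro N) auto
      with that(2) show ?thesis by (auto simp: \<delta>_def)
    qed
    with one keys \<delta> have "frag_of \<alpha> - frag_of \<delta> - (\<Sum>j = 1..k. line j \<delta> (\<alpha> j) (\<delta> j)) \<in> G"
      by (intro frag_of_congruent_sum_lines) auto
    moreover have "(\<Sum>j = 1..k. line j \<delta> (\<alpha> j) (\<delta> j))
        = (\<Sum>j = 1..k. line j \<delta> t (\<delta> j)) + (\<Sum>j = 1..k. line j \<delta> (\<alpha> j) t)"
      unfolding sum.distrib[symmetric] by (intro sum.cong) (auto simp: line_def)
    ultimately show ?case by (simp add: marginal_def K_def algebra_simps)
  next
    case (diff y z)
    from G_diff[OF this] show ?case
      by (simp add: marginal_def frag_extend_diff sum_subtractf algebra_simps)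
  qed
  then have red: "x - frag_extend (\<lambda>_. K) x
      - (\<Sum>j = 1..k. frag_extend (\<lambda>p. line j \<delta> p t) (marginal j x)) \<in> G" by simp
  have "(\<Sum>j = 1..k. frag_extend (\<lambda>p. line j \<delta> p t) (marginal j x)) \<in> G"
  proof (rule sum_marginals_in_subspace[OF subspace x])
    fix p v assume p: "p \<in> ?P" and v: "v \<in> relation_lattice k a"
    show "combination k (\<lambda>j. line j \<delta> p t) v \<in> G"
    proof (rule combination_in_subspace_span[OF subspace])
      show "v \<in> frag_module.span B" using v span by simp
      fix v assume "v \<in> B"
      moreover have "1 \<le> t" "p \<noteq> t" using N[OF p] by (auto simp: t_def)
      ultimately obtain \<beta> where \<beta>: "\<And>j. j \<in> {1..k} \<Longrightarrow> (\<beta> j)(j := p) \<in> multi_index k"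
            "\<And>j. j \<in> {1..k} \<Longrightarrow> (\<beta> j)(j := t) \<in> multi_index k"
          and c: "combination k (\<lambda>j. line j (\<beta> j) p t) v \<in> G"
        using B[of v p t] pos[OF p] by blast
      \<comment> \<open>The entries \<open>\<beta> j\<close> are exchanged for those of \<open>\<delta>\<close>, position by position.\<close>
      have "(\<Sum>j = 1..k. frag_cmul (Poly_Mapping.lookup v j) (line j \<delta> p t - line j (\<beta> j) p t)) \<in> G"
        using \<beta> \<delta>_upd p
        by (intro frag_module.subspace_sum[OF subspace] frag_module.subspace_scale[OF subspace]
            line_congruent) auto
      from G_add[OF this c] show "combination k (\<lambda>j. line j \<delta> p t) v \<in> G"
        by (simp add: combination_def frag_module.scale_right_diff_distrib sum_subtractf)
    qed
  qed
  from G_add[OF red this] have "x - frag_extend (\<lambda>_. K) x \<in> G" by simp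
  moreover have "frag_extend (\<lambda>_. K) x = 0" using k a x by (rule frag_extend_const_ker_A)
  ultimately show "x \<in> G" by simp
qed

end

section \<open>The permutation action\<close>

lemma perm_act_diff: "perm_act k \<sigma> (x - y) = perm_act k \<sigma> x - perm_act k \<sigma> y"
  and perm_act_add: "perm_act k \<sigma> (x + y) = perm_act k \<sigma> x + perm_act k \<sigma> y"
  and perm_act_of: "perm_act k \<sigma> (frag_of \<alpha>) = frag_of (compose {1..k} \<sigma> \<alpha>)"
  and perm_act_cmul: "perm_act k \<sigma> (frag_cmul c x) = frag_cmul c (perm_act k \<sigma> x)"
  and perm_act_sum: "finite I \<Longrightarrow> perm_act k \<sigma> (sum h I) = (\<Sum>i\<in>I. perm_act k \<sigma> (h i))"
  by (simp_all add: perm_act_def frag_extend_diff frag_extend_add frag_extend_cmul frag_extend_sum comp_def)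

lemma marginal_perm_act:
  assumes "j \<in> {1..k}"
  shows "marginal j (perm_act k \<sigma> x) = frag_extend (\<lambda>p. frag_of (\<sigma> p)) (marginal j x)"
proof (induction x rule: frag_induction[OF subset_UNIV])
  case (3 x y)
  then show ?case by (simp add: marginal_def perm_act_diff frag_extend_diff)
qed (use assms in \<open>simp_all add: marginal_def perm_act_def compose_def\<close>)

lemma A_lin_perm_act: "A_lin k a (perm_act k \<sigma> x) = frag_extend (\<lambda>p. frag_of (\<sigma> p)) (A_lin k a x)"
  by (simp add: A_lin_eq_marginals frag_extend_sum frag_extend_cmul comp_def marginal_perm_act)

lemma perm_act_ker_A:
  assumes "\<sigma> \<in> carrier (BijGroup {1..})" "x \<in> ker_A k a"
  shows "perm_act k \<sigma> x \<in> ker_A k a"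
proof -
  have "Poly_Mapping.keys (perm_act k \<sigma> x)
          \<subseteq> (\<Union>\<alpha>\<in>Poly_Mapping.keys x. {compose {1..k} \<sigma> \<alpha>})"
    unfolding perm_act_def using keys_frag_extend[of _ x] by fastforce
  then show ?thesis
    using assms compose_multi_index[OF assms(1)] by (auto simp: ker_A_iff A_lin_perm_act)
qed

section \<open>The generators and their orbits\<close>

text \<open>
  In a quadratic element each position carries its two possible entries once with sign \<open>+\<close> and
  once with sign \<open>-\<close>, so all marginals vanish.
\<close>

lemma Quad_subset_ker_A: "Quad k \<subseteq> ker_A k a"
  unfolding Quad_def
proof (rule subsetI, elim CollectE exE conjE)
  fix v \<alpha> r s x y
  assume v: "v = frag_of \<alpha> + frag_of (\<alpha>(r := x, s := y)) - frag_of (\<alpha>(r := x)) - frag_of (\<alpha>(s := y))"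
    and rs: "r < s"
    and M: "\<alpha> \<in> multi_index k" "\<alpha>(r := x, s := y) \<in> multi_index k"
      "\<alpha>(r := x) \<in> multi_index k" "\<alpha>(s := y) \<in> multi_index k"
  note keys = subspace_keys_subset[of "multi_index k"]
  have "v \<in> {x. Poly_Mapping.keys x \<subseteq> multi_index k}"
    unfolding v
    by (intro frag_module.subspace_diff[OF keys] frag_module.subspace_add[OF keys]) (use M in auto)
  moreover have "marginal j v = 0" for j
    using rs by (simp add: v marginal_def frag_extend_diff frag_extend_add)
  ultimately show "v \<in> ker_A k a" by (simp add: ker_A_iff A_lin_eq_marginals)
qed

lemma f_elem_indices:
  assumes "j \<in> {1..k}" "\<And>l. l \<in> {1..k} - {j} \<Longrightarrow> 3 \<le> m l" "inj_on m ({1..k} - {j})" "i \<in> {1, 2}"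
  shows "restrict (m(j := i)) {1..k} \<in> multi_index k"
proof -
  have "i \<notin> m ` ({1..k} - {j})"
  proof
    assume "i \<in> m ` ({1..k} - {j})"
    then have "3 \<le> i" using assms(2) by blast
    with assms(4) show False by auto
  qed
  moreover have "inj_on (m(j := i)) ({1..k} - {j})"
    using assms(3) inj_on_cong[of "{1..k} - {j}" m "m(j := i)"] by simp
  ultimately have "inj_on (m(j := i)) (insert j ({1..k} - {j}))"
    unfolding inj_on_insert by (simp add: fun_upd_image)
  then have "inj_on (m(j := i)) {1..k}" using assms(1) by (simp add: insert_absorb)
  moreover have "1 \<le> (m(j := i)) l" if "l \<in> {1..k}" for l using assms(2)[of l] assms(4) that by auto
  ultimately show ?thesis by (auto simp: multi_index_iff)
qed

lemma marginal_f_elem: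
  assumes "j \<in> {1..k}" "l \<in> {1..k}"
  shows "marginal l (f_elem k j m) = (if l = j then frag_of 1 - frag_of 2 else 0)"
  using assms by (simp add: marginal_def f_elem_def frag_extend_diff)

text \<open>
  Only the marginal of \<open>f\<^sub>j\<close> in position \<open>j\<close> is nonzero, so \<open>A_lin\<close> sends \<open>f\<^sub>j\<close> to
  \<open>a\<^sub>j (e\<^sub>1 - e\<^sub>2)\<close>, and the relation satisfied by \<open>v\<close> makes the combination vanish.
\<close>

lemma combination_f_elem_in_ker_A:
  assumes m: "\<And>j l. j \<in> {1..k} \<Longrightarrow> l \<in> {1..k} - {j} \<Longrightarrow> 3 \<le> m j l"
      "\<And>j. j \<in> {1..k} \<Longrightarrow> inj_on (m j) ({1..k} - {j})"
    and v: "v \<in> relation_lattice k a"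
  shows "combination k (\<lambda>j. f_elem k j (m j)) v \<in> ker_A k a"
proof -
  have "f_elem k j (m j) \<in> carrier (free_Abelian_group (multi_index k))" if j: "j \<in> {1..k}" for j
    unfolding f_elem_def carrier_free_Abelian_group_iff
    using f_elem_indices[of j k "m j" 1] f_elem_indices[of j k "m j" 2] m j
    by (intro order_trans[OF keys_diff]) auto
  then have "combination k (\<lambda>j. f_elem k j (m j)) v \<in> carrier (free_Abelian_group (multi_index k))"
    unfolding combination_def
    by (intro sum_closed_free_Abelian_group) auto
  moreover have "A_lin k a (combination k (\<lambda>j. f_elem k j (m j)) v) = 0"
  proof -
    have "A_lin k a (f_elem k j (m j)) = frag_cmul (int (a j)) (frag_of 1 - frag_of 2)"
      if "j \<in> {1..k}" for j
      using that by (simp add: A_lin_eq_marginals marginal_f_elem if_distrib cong: if_cong)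
    then have "A_lin k a (combination k (\<lambda>j. f_elem k j (m j)) v)
        = (\<Sum>j = 1..k. frag_cmul (Poly_Mapping.lookup v j) (frag_cmul (int (a j)) (frag_of 1 - frag_of 2)))"
      by (simp add: combination_def A_lin_def frag_extend_sum comp_def frag_extend_cmul)
    also have "\<dots> = frag_cmul (\<Sum>j = 1..k. int (a j) * Poly_Mapping.lookup v j) (frag_of 1 - frag_of 2)"
      by (simp add: frag_module.scale_sum_left mult.commute)
    finally show ?thesis using v by (simp add: relation_lattice_def)
  qed
  ultimately show ?thesis by (simp add: ker_A_iff)
qed

lemma perm_act_f_elem:
  assumes "j \<in> {1..k}"
  shows "perm_act k \<sigma> (f_elem k j m) = line j (restrict (\<sigma> \<circ> m) {1..k}) (\<sigma> 1) (\<sigma> 2)"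
proof -
  have "compose {1..k} \<sigma> (restrict (m(j := i)) {1..k}) = (restrict (\<sigma> \<circ> m) {1..k})(j := \<sigma> i)" for i
    using assms by (auto simp: compose_def)
  then show ?thesis by (simp add: f_elem_def perm_act_diff perm_act_of line_def)
qed

text \<open>
  When \<open>x\<close> and \<open>y\<close> are new entries, exactly \<open>k + 2\<close> distinct numbers occur, so the element is the
  image of the quadratic element with entries \<open>1, \<dots>, k\<close> and alternatives \<open>k + 1\<close>, \<open>k + 2\<close>.
  This is why entries up to \<open>k + 2\<close> suffice in \<open>Quad k\<close>.
\<close>

lemma quad_in_Quad_orbit:
  assumes r: "1 \<le> r" "r < s" "s \<le> k"
    and M: "\<alpha> \<in> multi_index k" "\<alpha>(r := x, s := y) \<in> multi_index k"
      "\<alpha>(r := x) \<in> multi_index k" "\<alpha>(s := y) \<in> multi_index k"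
    and ne: "x \<noteq> \<alpha> r" "y \<noteq> \<alpha> s"
  shows "\<exists>v\<in>Quad k. frag_of \<alpha> + frag_of (\<alpha>(r := x, s := y)) - frag_of (\<alpha>(r := x)) - frag_of (\<alpha>(s := y))
           \<in> perm_orbit k v"
proof -
  define \<iota> where "\<iota> = (\<lambda>l\<in>{1..k}. l)"
  define g where "g = \<alpha>(k + 1 := x, k + 2 := y)"
  have xr: "x \<noteq> \<alpha> l" if "l \<in> {1..k}" for l
    using that multi_index_neq[OF M(3), of r l] ne r by (cases "l = r") auto
  have ys: "y \<noteq> \<alpha> l" if "l \<in> {1..k}" for l
    using that multi_index_neq[OF M(4), of s l] ne r by (cases "l = s") auto
  have xy: "x \<noteq> y" using multi_index_neq[OF M(2), of r s] r by auto
  have "\<forall>l\<in>{1..k}. 1 \<le> (\<alpha>(r := x, s := y)) l"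
    using M(2) unfolding multi_index_iff by blast
  from bspec[OF this, of r] bspec[OF this, of s] r have pos: "1 \<le> x" "1 \<le> y" by auto
  have dec: "{1..k + 2} = insert (k + 2) (insert (k + 1) {1..k})" by auto
  have "inj_on g {1..k}"
    using M(1) inj_on_cong[of "{1..k}" \<alpha> g] by (simp add: g_def multi_index_iff)
  moreover have "g ` {1..k} = \<alpha> ` {1..k}"
    by (rule image_cong) (auto simp: g_def)
  then have "g (k + 1) \<notin> g ` {1..k}" "g (k + 2) \<notin> insert (g (k + 1)) (g ` {1..k})"
    using xr ys xy by (simp_all add: g_def image_iff)
  ultimately have "inj_on g {1..k + 2}"
    unfolding dec by (simp add: inj_on_insert)
  moreover have "g ` {1..k + 2} \<subseteq> {1..}"
    unfolding dec using M(1) pos by (auto simp: g_def multi_index_iff)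
  ultimately obtain \<sigma> where \<sigma>: "\<sigma> \<in> carrier (BijGroup {1..})" "\<And>l. l \<in> {1..k + 2} \<Longrightarrow> \<sigma> l = g l"
    using BijGroup_extend_finite_inj[of "{1..k + 2}" "{1..}" g] by auto
  have \<iota>: "\<iota> \<in> multi_index k" "\<iota>(r := k + 1, s := k + 2) \<in> multi_index k"
      "\<iota>(r := k + 1) \<in> multi_index k" "\<iota>(s := k + 2) \<in> multi_index k"
    using r by (auto simp: \<iota>_def multi_index_iff intro!: inj_onI split: if_splits)
  have "compose {1..k} \<sigma> \<iota> = \<alpha>"
    using M(1) \<sigma>(2) by (simp add: compose_def \<iota>_def g_def multi_index_iff fun_eq_iff)
  then have c: "compose {1..k} \<sigma> \<iota> = \<alpha>"
      "compose {1..k} \<sigma> (\<iota>(r := k + 1, s := k + 2)) = \<alpha>(r := x, s := y)"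
      "compose {1..k} \<sigma> (\<iota>(r := k + 1)) = \<alpha>(r := x)"
      "compose {1..k} \<sigma> (\<iota>(s := k + 2)) = \<alpha>(s := y)"
    using r \<sigma>(2) by (simp_all add: compose_upd g_def)
  let ?v = "frag_of \<iota> + frag_of (\<iota>(r := k + 1, s := k + 2)) - frag_of (\<iota>(r := k + 1)) - frag_of (\<iota>(s := k + 2))"
  have "\<iota> \<in> {1..k} \<rightarrow>\<^sub>E {1..k + 2}" by (auto simp: \<iota>_def)
  with r \<iota> have "?v \<in> Quad k"
    unfolding Quad_def mem_Collect_eq
    by (intro exI[of _ \<iota>] exI[of _ r] exI[of _ s] exI[of _ "k + 1"] exI[of _ "k + 2"] conjI refl) simp_all
  moreover have "perm_act k \<sigma> ?v = frag_of \<alpha> + frag_of (\<alpha>(r := x, s := y)) - frag_of (\<alpha>(r := x)) - frag_of (\<alpha>(s := y))"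
    by (simp only: perm_act_diff perm_act_add perm_act_of c)
  moreover have "perm_act k \<sigma> ?v \<in> perm_orbit k ?v" using \<sigma>(1) unfolding perm_orbit_def by blast
  ultimately show ?thesis by (intro bexI[of _ ?v]) simp_all
qed

text \<open>
  If an alternative entry equals the original one, the quadratic element is zero; otherwise, up to
  exchanging the two positions, \<open>quad_in_Quad_orbit\<close> applies.
\<close>

lemma quad_closed_if_Quad_orbits:
  assumes "frag_module.subspace G" and orb: "\<And>v. v \<in> Quad k \<Longrightarrow> perm_orbit k v \<subseteq> G"
  shows "quad_closed k G"
proof
  show "frag_module.subspace G" by fact
  fix \<alpha> r s x y
  assume rs: "r \<in> {1..k}" "s \<in> {1..k}" "r \<noteq> s"
    and M: "\<alpha> \<in> multi_index k" "\<alpha>(r := x, s := y) \<in> multi_index k"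
      "\<alpha>(r := x) \<in> multi_index k" "\<alpha>(s := y) \<in> multi_index k"
  consider "x = \<alpha> r \<or> y = \<alpha> s" | "x \<noteq> \<alpha> r" "y \<noteq> \<alpha> s" "r < s" | "x \<noteq> \<alpha> r" "y \<noteq> \<alpha> s" "s < r"
    using rs(3) by linarith
  then show "frag_of \<alpha> + frag_of (\<alpha>(r := x, s := y)) - frag_of (\<alpha>(r := x)) - frag_of (\<alpha>(s := y)) \<in> G"
  proof cases
    case 1
    moreover have "\<alpha>(r := x, s := y) = \<alpha>(r := x)" if "y = \<alpha> s" using that rs(3) by auto
    ultimately show ?thesis using frag_module.subspace_0[OF assms(1)] by auto
  next
    case 2
    with quad_in_Quad_orbit[of r s k \<alpha> x y] rs M orb show ?thesis by auto
  next
    case 3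
    with quad_in_Quad_orbit[of s r k \<alpha> y x] rs M orb
    show ?thesis by (auto simp: fun_upd_twist algebra_simps)
  qed
qed

text \<open>
  Integer multiples are iterated sums, so subgroups are submodules.  This makes linear algebra over
  \<open>\<int>\<close> available for the subgroup generated by the orbits.
\<close>

lemma subspace_generate_free_Abelian_group:
  assumes "S \<subseteq> carrier (free_Abelian_group A)"
  shows "frag_module.subspace (generate (free_Abelian_group A) S)"
proof -
  let ?G = "generate (free_Abelian_group A) S"
  interpret F: group "free_Abelian_group A" by simp
  have sub: "?G \<subseteq> carrier (free_Abelian_group A)" using F.generate_incl[OF assms] .
  have zero: "0 \<in> ?G" using generate.one[of "free_Abelian_group A" S] by simp
  have add: "x + y \<in> ?G" if "x \<in> ?G" "y \<in> ?G" for x y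
    using generate.eng[OF that] by simp
  have neg: "- x \<in> ?G" if "x \<in> ?G" for x
    using F.generate_m_inv_closed[OF assms that] sub that by auto
  have diff: "x - y \<in> ?G" if "x \<in> ?G" "y \<in> ?G" for x y
    using add[OF that(1) neg[OF that(2)]] by simp
  show ?thesis
    unfolding frag_module.subspace_def
    using zero add frag_closure_minus_cmul[of "\<lambda>x. x \<in> ?G", OF zero diff] by blast
qed

theorem theorem2p5:
  fixes k :: nat
    and a :: "nat \<Rightarrow> nat"
    and b :: "nat \<Rightarrow> (nat \<Rightarrow>\<^sub>0 int)"
    and m :: "nat \<Rightarrow> nat \<Rightarrow> nat"
    and f w :: "nat \<Rightarrow> ((nat \<Rightarrow> nat) \<Rightarrow>\<^sub>0 int)"
  assumes "1 \<le> k"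
    and "\<And>j. j \<in> {1..k} \<Longrightarrow> 1 \<le> a j"
    and "lattice_basis {1..k - 1} b (relation_lattice k a)"
    and "\<And>j l. j \<in> {1..k} \<Longrightarrow> l \<in> {1..k} - {j} \<Longrightarrow> 3 \<le> m j l"
    and "\<And>j. j \<in> {1..k} \<Longrightarrow> inj_on (m j) ({1..k} - {j})"
    and "\<And>j. j \<in> {1..k} \<Longrightarrow> f j = f_elem k j (m j)"
    and "\<And>i. i \<in> {1..k - 1} \<Longrightarrow>
           w i = (\<Sum>j = 1..k. frag_cmul (Poly_Mapping.lookup (b i) j) (f j))"
  shows "equivariant_lattice_generating_set k (ker_A k a) (Quad k \<union> w ` {1..k - 1})"
proof -
  let ?V = "Quad k \<union> w ` {1..k - 1}" and ?L = "ker_A k a"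
  define G where "G = generate (Lam k) (\<Union>v \<in> ?V. perm_orbit k v)"
  have b: "b i \<in> relation_lattice k a" if "i \<in> {1..k - 1}" for i
    using assms(3) that frag_module.span_base[of "b i" "b ` {1..k - 1}"]
    by (auto simp: lattice_basis_def)
  have w: "w i = combination k (\<lambda>j. f_elem k j (m j)) (b i)" if "i \<in> {1..k - 1}" for i
    using assms(6,7) that by (simp add: combination_def)
  have V: "?V \<subseteq> ?L"
    using Quad_subset_ker_A combination_f_elem_in_ker_A[OF assms(4,5) b] w by auto
  have orbits: "(\<Union>v \<in> ?V. perm_orbit k v) \<subseteq> ?L"
    unfolding perm_orbit_def using V perm_act_ker_A by blast
  have L: "?L \<subseteq> carrier (Lam k)" by (auto simp: ker_A_iff Lam_def)
  have L_subgroup: "subgroup ?L (Lam k)"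
  proof
    show "inv\<^bsub>Lam k\<^esub> x \<in> ?L" if "x \<in> ?L" for x
      using that L frag_module.subspace_neg[OF subspace_ker_A that] by (auto simp: Lam_def)
  qed (use L frag_module.subspace_add[OF subspace_ker_A] frag_module.subspace_0[OF subspace_ker_A]
        in \<open>auto simp: Lam_def\<close>)
  have G_subspace: "frag_module.subspace G"
    unfolding G_def Lam_def
    by (rule subspace_generate_free_Abelian_group[OF order_trans[OF orbits L[unfolded Lam_def]]])
  have orbit_G: "perm_orbit k v \<subseteq> G" if "v \<in> ?V" for v
    unfolding G_def using that by (intro subsetI generate.incl UN_I)
  interpret quad_closed k G
    by (intro quad_closed_if_Quad_orbits G_subspace orbit_G UnI1)
  have "?L \<subseteq> G"
  proof (rule ker_A_subset[OF assms(1,2)])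
    show "frag_module.span (b ` {1..k - 1}) = relation_lattice k a"
      using assms(3) by (simp add: lattice_basis_def)
    fix v p t assume "v \<in> b ` {1..k - 1}" and pt: "1 \<le> p" "1 \<le> t" "p \<noteq> (t :: nat)"
    then obtain i where i: "i \<in> {1..k - 1}" "v = b i" by auto
    \<comment> \<open>The permutation that carries the lines \<open>f\<^sub>j\<close> from \<open>1\<close>, \<open>2\<close> to \<open>p\<close>, \<open>t\<close>.\<close>
    have "inj_on (\<lambda>l. if l = 1 then p else t) {1, 2 :: nat}" using pt(3) by (auto simp: inj_on_def)
    then obtain \<sigma> where \<sigma>: "\<sigma> \<in> carrier (BijGroup {1..})"
        "\<And>l. l \<in> {1, 2} \<Longrightarrow> \<sigma> l = (if l = 1 then p else t)"
      by (rule BijGroup_extend_finite_inj[of "{1, 2}" "{1..}", rotated 2]) (use pt in auto)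
    have \<sigma>12: "\<sigma> 1 = p" "\<sigma> 2 = t" using \<sigma>(2) by auto
    define \<beta> where "\<beta> j = restrict (\<sigma> \<circ> m j) {1..k}" for j
    have \<beta>: "(\<beta> j)(j := \<sigma> l) \<in> multi_index k" if "j \<in> {1..k}" "l \<in> {1, 2}" for j l
    proof -
      have "(\<beta> j)(j := \<sigma> l) = compose {1..k} \<sigma> (restrict ((m j)(j := l)) {1..k})"
        using that(1) by (auto simp: compose_def \<beta>_def)
      moreover have "restrict ((m j)(j := l)) {1..k} \<in> multi_index k"
        using that assms(4,5) by (intro f_elem_indices)
      ultimately show ?thesis using compose_multi_index[OF \<sigma>(1)] by simp
    qed
    have "perm_act k \<sigma> (w i) = combination k (\<lambda>j. line j (\<beta> j) p t) v"
      using \<sigma>12 i w by (simp add: combination_def perm_act_sum perm_act_cmul perm_act_f_elem \<beta>_def)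
    moreover have "perm_act k \<sigma> (w i) \<in> G"
      using orbit_G[of "w i"] i \<sigma>(1) by (auto simp: perm_orbit_def)
    moreover have "\<forall>j\<in>{1..k}. (\<beta> j)(j := p) \<in> multi_index k \<and> (\<beta> j)(j := t) \<in> multi_index k"
      using \<beta>[of _ 1] \<beta>[of _ 2] unfolding \<sigma>12 by simp
    ultimately show "\<exists>\<beta>. (\<forall>j\<in>{1..k}. (\<beta> j)(j := p) \<in> multi_index k \<and> (\<beta> j)(j := t) \<in> multi_index k) \<and>
            combination k (\<lambda>j. line j (\<beta> j) p t) v \<in> G"
      by (intro exI[of _ \<beta>] conjI) simp_all
  qed
  moreover have "G \<subseteq> ?L"
    unfolding G_def using orbits L_subgroup
    by (intro group.generate_subgroup_incl) (simp_all add: Lam_def)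
  ultimately show ?thesis
    using L_subgroup V perm_act_ker_A unfolding equivariant_lattice_generating_set_def G_def by blast
qed

end
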